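(* Let $G$ be a topological group, $H$ a compact covering group of $G$ with covering map $\varphi: H\to G$, and let $V_0,V_1,\dots,V_K$ ($K\ge 1$) be finite-dimensional vector spaces over $\mathbb{F}$. For each $k$ let $\rho_k: G\to\mathrm{PGL}(V_k)$ be a projective representation and $\widehat\rho_k: H\to\mathrm{GL}(V_k)$ a lift of $\rho_k$. For $k=0,\dots,K-1$ and $\varepsilon\in H^*$, let $A_k^\varepsilon: V_k\to V_{k+1}$ be a linear map in $$U_k^\varepsilon=\{A\in\mathrm{Hom}(V_k,V_{k+1}) : \widehat\rho_{k+1}(h)A\widehat\rho_k(h)^{-1}=\varepsilon(h)A\ \text{ for all } h\in H\},$$ and let $\sigma_k: V_{k+1}\to V_{k+1}$ be a (not necessarily linear) map that is equivariant, i.e. $\sigma_k(\widehat\rho_{k+1}(h)x)=\widehat\rho_{k+1}(h)\sigma_k(x)$ for all $h\in H$, $x\in V_{k+1}$. Define maps $v_k^\varepsilon: V_0\to V_k$ for $k=1,\dots,K$, $\varepsilon\in H^*$, by $$v_1^\varepsilon(v)=\sigma_0(A_0^\varepsilon v),\qquad v_{k+1}^\varepsilon(v)=\sigma_k\Big(\sum_{\gamma,\delta\in H^*,\ \gamma\delta=\varepsilon}A_k^\gamma v_k^\delta(v)\Big)\quad (1\le k\le K-1).$$ Suppose that each $\sigma_k$ commutes with the scalars $\varepsilon(h)$, i.e. $\sigma_k(\varepsilon(h)x)=\varepsilon(h)\sigma_k(x)$ for all $\varepsilon\in H^*$, $h\in H$, $x\in V_{k+1}$. Then all features $v_k^\varepsilon$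 are projectively equivariant: for all $k=1,\dots,K$, $\varepsilon\in H^*$, $h\in H$ and $v\in V_0$, the vectors $v_k^\varepsilon(\widehat\rho_0(h)v)$ and $\widehat\rho_k(h)v_k^\varepsilon(v)$ of $V_k$ are equal up to multiplication by a nonzero scalar in $\mathbb{F}$.
   Context: $\mathbb{F}$ denotes $\mathbb{R}$ or $\mathbb{C}$. $\mathrm{PGL}(V)$ is $\mathrm{GL}(V)$ modulo nonzero scalar multiples of the identity, with projection $\Pi_{\mathrm{GL}(V)}:\mathrm{GL}(V)\to\mathrm{PGL}(V)$. A projective representation of $G$ on $\mathrm{P}(V)$ is a group homomorphism $G\to\mathrm{PGL}(V)$; a linear representation of a topological group $H$ on $V$ is a continuous group homomorphism $H\to\mathrm{GL}(V)$. $\mathrm{Hom}(V,W)$ is the space of linear maps $V\to W$. $H$ is a covering group of $G$ if there is a covering map $\varphi: H\to G$, i.e. a surjective continuous group homomorphism which maps some neighbourhood of the unit element of $H$ homeomorphically onto a neighbourhood of the unit element of $G$. A lift of $\rho: G\to\mathrm{PGL}(V)$ is a linear representation $\widehat\rho: H\to\mathrm{GL}(V)$ with $\rho\circ\varphi=\Pi_{\mathrm{GL}(V)}\circ\widehat\rho$. The character group $H^*$ is the set of continuous group homomorphisms $\varepsilon: H\to\mathbb{F}\setminus\{0\}$, with pointwise multiplication. For fixed $k$, only finitely many of the spaces $U_k^\varepsilon$, $\varepsilon\in H^*$, are nonzero (by finite-dimensionality), so the sums in the definition of $v_{k+1}^\varepsilon$ have only finitely many nonzero terms. *)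

theory Defs
  imports "HOL-Analysis.Analysis" "HOL-Algebra.Coset" "HOL-Algebra.Bij"
begin

text \<open>
  The ground field is a type of class \<open>real_normed_field\<close>. Up to isomorphism of topological
  fields, the only such fields are the real and the complex numbers (Gelfand--Mazur).

  A family of vector spaces is a family of subspaces of one ambient vector space, given by a type
  and a scalar multiplication \<open>s\<close> satisfying the library predicate \<open>vector_space\<close>. This is no loss of
  generality, since every family of vector spaces over one field embeds in its direct sum.
  Maps between carriers are extensional, so that equality of maps is equality on the carrier.
\<close>

definition fin_dim_subspace ::
    "('f::field \<Rightarrow> 'v::ab_group_add \<Rightarrow> 'v) \<Rightarrow> 'v set \<Rightarrow> bool" where
  "fin_dim_subspace s V \<longleftrightarrow> module.subspace s V \<and> (\<exists>B. finite B \<and> V = module.span s B)"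

definition Hom ::
    "('f::field \<Rightarrow> 'v::ab_group_add \<Rightarrow> 'v) \<Rightarrow> 'v set \<Rightarrow>
     ('f \<Rightarrow> 'w::ab_group_add \<Rightarrow> 'w) \<Rightarrow> 'w set \<Rightarrow> ('v \<Rightarrow> 'w) set" where
  "Hom s V t W =
     {A \<in> V \<rightarrow>\<^sub>E W. (\<forall>x\<in>V. \<forall>y\<in>V. A (x + y) = A x + A y) \<and>
                   (\<forall>c. \<forall>x\<in>V. A (s c x) = t c (A x))}"

abbreviation dual ::
    "('f::field \<Rightarrow> 'v::ab_group_add \<Rightarrow> 'v) \<Rightarrow> 'v set \<Rightarrow> ('v \<Rightarrow> 'f) set" where
  "dual s V \<equiv> Hom s V (*) UNIV"

definition GL ::
    "('f::field \<Rightarrow> 'v::ab_group_add \<Rightarrow> 'v) \<Rightarrow> 'v set \<Rightarrow> ('v \<Rightarrow> 'v) monoid" where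
  "GL s V = (BijGroup V)\<lparr>carrier := Hom s V s V \<inter> Bij V\<rparr>"

text \<open>
  The standard topology on \<open>GL s V\<close>: the coarsest one making all matrix coefficients
  \<open>A \<mapsto> l (A x)\<close> continuous. For finite-dimensional \<open>V\<close> it is the subspace topology from the
  unique Hausdorff vector space topology on the endomorphisms of \<open>V\<close>.
\<close>

definition GL_topology ::
    "('f::real_normed_field \<Rightarrow> 'v::ab_group_add \<Rightarrow> 'v) \<Rightarrow> 'v set \<Rightarrow> ('v \<Rightarrow> 'v) topology" where
  "GL_topology s V = topology_generated_by
     {{A \<in> carrier (GL s V). l (A x) \<in> U} | l x U. l \<in> dual s V \<and> x \<in> V \<and> open U}"

definition scalar_maps ::
    "('f::field \<Rightarrow> 'v::ab_group_add \<Rightarrow> 'v) \<Rightarrow> 'v set \<Rightarrow> ('v \<Rightarrow> 'v) set" where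
  "scalar_maps s V = {\<lambda>x\<in>V. s c x | c. c \<noteq> 0}"

definition PGL ::
    "('f::field \<Rightarrow> 'v::ab_group_add \<Rightarrow> 'v) \<Rightarrow> 'v set \<Rightarrow> ('v \<Rightarrow> 'v) set monoid" where
  "PGL s V = GL s V Mod scalar_maps s V"

definition PGL_proj ::
    "('f::field \<Rightarrow> 'v::ab_group_add \<Rightarrow> 'v) \<Rightarrow> 'v set \<Rightarrow> ('v \<Rightarrow> 'v) \<Rightarrow> ('v \<Rightarrow> 'v) set" where
  "PGL_proj s V g = scalar_maps s V #>\<^bsub>GL s V\<^esub> g"

locale topological_group = group G for G (structure) +
  fixes T :: "'a topology"
  assumes topspace_eq: "topspace T = carrier G"
    and continuous_mult: "continuous_map (prod_topology T T) T (\<lambda>(x, y). x \<otimes> y)"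
    and continuous_inv: "continuous_map T T (\<lambda>x. inv x)"

definition unit_nhd :: "('a, 'm) monoid_scheme \<Rightarrow> 'a topology \<Rightarrow> 'a set \<Rightarrow> bool" where
  "unit_nhd G T N \<longleftrightarrow> N \<subseteq> carrier G \<and> (\<exists>U. openin T U \<and> \<one>\<^bsub>G\<^esub> \<in> U \<and> U \<subseteq> N)"

definition group_covering_map ::
    "('h, 'm) monoid_scheme \<Rightarrow> 'h topology \<Rightarrow> ('g, 'n) monoid_scheme \<Rightarrow> 'g topology \<Rightarrow>
     ('h \<Rightarrow> 'g) \<Rightarrow> bool" where
  "group_covering_map H TH G TG \<phi> \<longleftrightarrow>
     \<phi> \<in> hom H G \<and> continuous_map TH TG \<phi> \<and> \<phi> ` carrier H = carrier G \<and>
     (\<exists>N M. unit_nhd H TH N \<and> unit_nhd G TG M \<and>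
            homeomorphic_map (subtopology TH N) (subtopology TG M) \<phi>)"

definition projective_rep ::
    "('g, 'n) monoid_scheme \<Rightarrow> ('f::field \<Rightarrow> 'v::ab_group_add \<Rightarrow> 'v) \<Rightarrow> 'v set \<Rightarrow>
     ('g \<Rightarrow> ('v \<Rightarrow> 'v) set) \<Rightarrow> bool" where
  "projective_rep G s V \<rho> \<longleftrightarrow> \<rho> \<in> hom G (PGL s V)"

definition linear_rep ::
    "('h, 'm) monoid_scheme \<Rightarrow> 'h topology \<Rightarrow>
     ('f::real_normed_field \<Rightarrow> 'v::ab_group_add \<Rightarrow> 'v) \<Rightarrow> 'v set \<Rightarrow> ('h \<Rightarrow> 'v \<Rightarrow> 'v) \<Rightarrow> bool" where
  "linear_rep H TH s V R \<longleftrightarrow> R \<in> hom H (GL s V) \<and> continuous_map TH (GL_topology s V) R"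

definition is_lift ::
    "('h, 'm) monoid_scheme \<Rightarrow> 'h topology \<Rightarrow> ('h \<Rightarrow> 'g) \<Rightarrow>
     ('f::real_normed_field \<Rightarrow> 'v::ab_group_add \<Rightarrow> 'v) \<Rightarrow> 'v set \<Rightarrow>
     ('g \<Rightarrow> ('v \<Rightarrow> 'v) set) \<Rightarrow> ('h \<Rightarrow> 'v \<Rightarrow> 'v) \<Rightarrow> bool" where
  "is_lift H TH \<phi> s V \<rho> R \<longleftrightarrow>
     linear_rep H TH s V R \<and> (\<forall>h\<in>carrier H. \<rho> (\<phi> h) = PGL_proj s V (R h))"

text \<open>
  Characters are extensional, so that each one is counted exactly once in sums over the
  character group.
\<close>

definition character_group ::
    "('h, 'm) monoid_scheme \<Rightarrow> 'h topology \<Rightarrow> ('h \<Rightarrow> 'f::real_normed_field) monoid" where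
  "character_group H TH =
     \<lparr>carrier = {\<epsilon> \<in> carrier H \<rightarrow>\<^sub>E UNIV - {0}.
                  continuous_map TH (top_of_set (UNIV - {0})) \<epsilon> \<and>
                  (\<forall>g\<in>carrier H. \<forall>h\<in>carrier H. \<epsilon> (g \<otimes>\<^bsub>H\<^esub> h) = \<epsilon> g * \<epsilon> h)},
      mult = \<lambda>\<gamma> \<delta>. \<lambda>h\<in>carrier H. \<gamma> h * \<delta> h,
      one = \<lambda>h\<in>carrier H. 1\<rparr>"

definition U_space ::
    "('h, 'm) monoid_scheme \<Rightarrow> ('f::field \<Rightarrow> 'v::ab_group_add \<Rightarrow> 'v) \<Rightarrow> 'v set \<Rightarrow> 'v set \<Rightarrow>
     ('h \<Rightarrow> 'v \<Rightarrow> 'v) \<Rightarrow> ('h \<Rightarrow> 'v \<Rightarrow> 'v) \<Rightarrow> ('h \<Rightarrow> 'f) \<Rightarrow> ('v \<Rightarrow> 'v) set" where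
  "U_space H s V W R R' \<epsilon> =
     {A \<in> Hom s V s W. \<forall>h\<in>carrier H. \<forall>x\<in>V.
        R' h (A ((inv\<^bsub>GL s V\<^esub> (R h)) x)) = s (\<epsilon> h) (A x)}"

text \<open>
  The argument of the nonlinearity in the recursion for the features. The library's \<open>sum\<close> is \<open>0\<close>
  over infinite index sets, so the sum is taken over the nonzero terms; there are finitely many
  of them when \<open>A \<gamma>\<close> lies in \<open>U_space H s V W R R' \<gamma>\<close> for all \<open>\<gamma>\<close>, as only finitely many of
  these spaces are nonzero for finite-dimensional \<open>V\<close> and \<open>W\<close>.
\<close>

definition convolve ::
    "('h \<Rightarrow> 'f) monoid \<Rightarrow> (('h \<Rightarrow> 'f) \<Rightarrow> 'v \<Rightarrow> 'v::ab_group_add) \<Rightarrow>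
     (('h \<Rightarrow> 'f) \<Rightarrow> 'v \<Rightarrow> 'v) \<Rightarrow> ('h \<Rightarrow> 'f) \<Rightarrow> 'v \<Rightarrow> 'v" where
  "convolve X A u \<epsilon> x =
     (\<Sum>(\<gamma>, \<delta>) \<in> {(\<gamma>, \<delta>). \<gamma> \<in> carrier X \<and> \<delta> \<in> carrier X \<and> \<gamma> \<otimes>\<^bsub>X\<^esub> \<delta> = \<epsilon> \<and> A \<gamma> (u \<delta> x) \<noteq> 0}.
        A \<gamma> (u \<delta> x))"

end

theory Submission
  imports Defs
begin

text \<open>
  The intertwining relation says that \<open>A \<gamma> \<circ> R h = \<gamma> (h\<inverse>) \<cdot> R' h \<circ> A \<gamma>\<close>. By induction on the layer,
  the feature \<open>v k \<epsilon>\<close> satisfies \<open>v k \<epsilon> (R 0 h x) = \<epsilon> (h\<inverse>) \<cdot> R k h (v k \<epsilon> x)\<close>: in the convolution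
  every term with \<open>\<gamma>\<delta> = \<epsilon>\<close> picks up the same scalar \<open>\<gamma> (h\<inverse>) \<delta> (h\<inverse>) = \<epsilon> (h\<inverse>)\<close>, which can be
  moved through the nonlinearity because it is itself a value of the character \<open>\<epsilon>\<close>.
\<close>

lemma character_groupD:
  assumes "group H" and "\<epsilon> \<in> carrier (character_group H TH)" and "h \<in> carrier H"
  shows character_nonzero: "\<epsilon> h \<noteq> 0"
    and character_inv: "\<epsilon> (inv\<^bsub>H\<^esub> h) = inverse (\<epsilon> h)"
proof -
  interpret group H by fact
  have nz: "\<epsilon> g \<noteq> 0" if "g \<in> carrier H" for g
    using assms(2) that by (auto simp: character_group_def PiE_iff)
  have mult: "\<epsilon> (g \<otimes>\<^bsub>H\<^esub> g') = \<epsilon> g * \<epsilon> g'" if "g \<in> carrier H" "g' \<in> carrier H" for g g'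
    using assms(2) that by (auto simp: character_group_def)
  show "\<epsilon> h \<noteq> 0"
    by (rule nz) fact
  \<comment> \<open>A character sends the unit to an idempotent of the field, and the only nonzero
    idempotent is 1.\<close>
  have "\<epsilon> \<one>\<^bsub>H\<^esub> = 1"
    using mult[of "\<one>\<^bsub>H\<^esub>" "\<one>\<^bsub>H\<^esub>"] nz[of "\<one>\<^bsub>H\<^esub>"] by simp
  then have "\<epsilon> h * \<epsilon> (inv\<^bsub>H\<^esub> h) = 1"
    using mult[of h "inv\<^bsub>H\<^esub> h"] assms(3) by simp
  then show "\<epsilon> (inv\<^bsub>H\<^esub> h) = inverse (\<epsilon> h)"
    by (simp add: inverse_unique)
qed

lemma is_lift_GL:
  "is_lift H TH \<phi> s V \<rho> R \<Longrightarrow> h \<in> carrier H \<Longrightarrow> R h \<in> carrier (GL s V)"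
  by (auto simp: is_lift_def linear_rep_def hom_def)

lemma carrier_BijGroup: "carrier (BijGroup V) = Bij V"
  by (simp add: BijGroup_def)

lemma GL_mult: "f \<in> Bij V \<Longrightarrow> g \<in> Bij V \<Longrightarrow> f \<otimes>\<^bsub>GL s V\<^esub> g = compose V f g"
  by (simp add: GL_def BijGroup_def)

lemma GL_one: "\<one>\<^bsub>GL s V\<^esub> = (\<lambda>x\<in>V. x)"
  by (simp add: GL_def BijGroup_def)

context vector_space
begin

lemma Hom_closed: "A \<in> Hom scale V scale W \<Longrightarrow> x \<in> V \<Longrightarrow> A x \<in> W"
  by (auto simp: Hom_def)

lemma Hom_add: "A \<in> Hom scale V scale W \<Longrightarrow> x \<in> V \<Longrightarrow> y \<in> V \<Longrightarrow> A (x + y) = A x + A y"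
  by (auto simp: Hom_def)

lemma Hom_scale: "A \<in> Hom scale V scale W \<Longrightarrow> x \<in> V \<Longrightarrow> A (scale c x) = scale c (A x)"
  by (auto simp: Hom_def)

lemma Hom_zero:
  assumes "A \<in> Hom scale V scale W" and "subspace V"
  shows "A 0 = 0"
  using Hom_add[OF assms(1), of 0 0] subspace_0[OF assms(2)] by simp

text \<open>Valid for arbitrary index sets: over an infinite one both sums are 0 by convention, and
  \<open>A 0 = 0\<close>. This spares a finiteness proof for the index set of
  \<open>convolve\<close>.\<close>

lemma Hom_sum:
  assumes "A \<in> Hom scale V scale W" and "subspace V" and "\<And>i. i \<in> I \<Longrightarrow> f i \<in> V"
  shows "A (\<Sum>i\<in>I. f i) = (\<Sum>i\<in>I. A (f i))"
  using assms(3)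
proof (induction I rule: infinite_finite_induct)
  case (insert i I)
  then have "f i \<in> V" and "(\<Sum>i\<in>I. f i) \<in> V"
    by (auto intro: subspace_sum[OF assms(2)])
  then show ?case
    using insert by (simp add: Hom_add[OF assms(1)])
qed (simp_all add: Hom_zero[OF assms(1,2)])

text \<open>Linear bijections form a subgroup of \<open>BijGroup V\<close>. Only with this is the
  \<open>inv\<close> in \<open>U_space\<close>, taken in \<open>GL\<close>, known to be a true
  inverse.\<close>

lemma group_GL:
  assumes "subspace V"
  shows "group (GL scale V)"
proof -
  interpret B: group "BijGroup V"
    by (rule group_BijGroup)
  have "subgroup (Hom scale V scale V \<inter> Bij V) (BijGroup V)"
  proof (rule B.subgroupI)
    show "Hom scale V scale V \<inter> Bij V \<subseteq> carrier (BijGroup V)"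
      by (auto simp: BijGroup_def)
    have "(\<lambda>x\<in>V. x) \<in> Hom scale V scale V"
      using assms by (auto simp: Hom_def subspace_add subspace_scale)
    then show "Hom scale V scale V \<inter> Bij V \<noteq> {}"
      using id_Bij by blast
  next
    fix f assume "f \<in> Hom scale V scale V \<inter> Bij V"
    then have f: "f \<in> Hom scale V scale V" "f \<in> Bij V" by auto
    \<comment> \<open>The restriction to \<open>V\<close> gives the extensionality demanded by
      \<open>Hom\<close> and is the form in which \<open>inv_BijGroup\<close> presents the
      inverse.\<close>
    define g where "g = (\<lambda>x\<in>V. inv_into V f x)"
    have inj: "inj_on f V" and surj: "f ` V = V"
      using f(2) by (auto simp: Bij_def bij_betw_def)
    have gV: "g x \<in> V" and fg: "f (g x) = x" if "x \<in> V" for x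
      using that surj by (auto simp: g_def inv_into_into f_inv_into_f)
    \<comment> \<open>Linearity of \<open>g\<close> is pulled back from that of \<open>f\<close>:
      vectors of \<open>V\<close> agree once their images under the injective \<open>f\<close>
      do.\<close>
    have eqI: "y = z" if "y \<in> V" "z \<in> V" "f y = f z" for y z
      using inj that by (auto dest: inj_onD)
    have "g (x + y) = g x + g y" if "x \<in> V" "y \<in> V" for x y
      by (rule eqI) (use that in \<open>auto simp: gV fg Hom_add[OF f(1)] subspace_add[OF assms]\<close>)
    moreover have "g (scale c x) = scale c (g x)" if "x \<in> V" for c x
      by (rule eqI) (use that in \<open>auto simp: gV fg Hom_scale[OF f(1)] subspace_scale[OF assms]\<close>)
    ultimately have "g \<in> Hom scale V scale V"
      using gV by (auto simp: Hom_def g_def)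
    moreover have "inv\<^bsub>BijGroup V\<^esub> f = g"
      using inv_BijGroup[OF f(2)] by (simp add: g_def)
    moreover have "inv\<^bsub>BijGroup V\<^esub> f \<in> Bij V"
      using B.inv_closed[of f] f(2) by (simp only: carrier_BijGroup)
    ultimately show "inv\<^bsub>BijGroup V\<^esub> f \<in> Hom scale V scale V \<inter> Bij V"
      by simp
  next
    fix f g assume "f \<in> Hom scale V scale V \<inter> Bij V" "g \<in> Hom scale V scale V \<inter> Bij V"
    moreover from this have "compose V f g \<in> Hom scale V scale V"
      using assms by (auto simp: Hom_def compose_def PiE_iff subspace_add subspace_scale)
    ultimately show "f \<otimes>\<^bsub>BijGroup V\<^esub> g \<in> Hom scale V scale V \<inter> Bij V"
      by (auto simp: BijGroup_def compose_Bij)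
  qed
  then show ?thesis
    unfolding GL_def by (rule B.subgroup_imp_group)
qed

lemma GL_inv_apply:
  assumes "subspace V" and "f \<in> carrier (GL scale V)" and "x \<in> V"
  shows "(inv\<^bsub>GL scale V\<^esub> f) (f x) = x"
proof -
  interpret group "GL scale V"
    using assms(1) by (rule group_GL)
  have "inv\<^bsub>GL scale V\<^esub> f \<in> Bij V" "f \<in> Bij V"
    using inv_closed[OF assms(2)] assms(2) by (auto simp: GL_def)
  then have "compose V (inv\<^bsub>GL scale V\<^esub> f) f = (\<lambda>x\<in>V. x)"
    using l_inv[OF assms(2)] by (simp only: GL_mult GL_one)
  then have "compose V (inv\<^bsub>GL scale V\<^esub> f) f x = (\<lambda>x\<in>V. x) x"
    by (rule fun_cong)
  then show ?thesis
    using assms(3) by (simp add: compose_eq)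
qed

text \<open>The relation defining \<open>U_space\<close> is taken at the vector
  \<open>R h x\<close>, where the inverse of \<open>R h\<close> cancels; then one divides by
  \<open>\<epsilon> h\<close>.\<close>

lemma U_space_commute:
  assumes "subspace V" and "A \<in> U_space H scale V W R R' \<epsilon>" and "h \<in> carrier H"
    and "R h \<in> carrier (GL scale V)" and "\<epsilon> h \<noteq> 0" and "x \<in> V"
  shows "A (R h x) = scale (inverse (\<epsilon> h)) (R' h (A x))"
proof -
  have "R h x \<in> V"
    using assms(4,6) by (auto simp: GL_def Hom_def)
  then have "R' h (A x) = scale (\<epsilon> h) (A (R h x))"
    using assms(2,3) GL_inv_apply[OF assms(1,4,6)] unfolding U_space_def by force
  then show ?thesis
    using assms(5) by simp
qed

text \<open>For \<open>convolve\<close>, which sums over nonzero terms only: an invertible linear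
  map applied to the terms does not change the index set.\<close>

lemma GL_eq_0_iff:
  assumes "subspace V" and "f \<in> carrier (GL scale V)" and "x \<in> V"
  shows "f x = 0 \<longleftrightarrow> x = 0"
proof -
  have "f 0 = 0" "inj_on f V"
    using assms Hom_zero[of f V V] by (auto simp: GL_def Bij_def bij_betw_def)
  then show ?thesis
    using subspace_0[OF assms(1)] assms(3) by (metis inj_onD)
qed

lemma convolve_closed:
  assumes "subspace W" and "\<And>\<gamma>. \<gamma> \<in> carrier X \<Longrightarrow> A \<gamma> \<in> Hom scale V scale W"
    and "\<And>\<delta>. \<delta> \<in> carrier X \<Longrightarrow> u \<delta> x \<in> V"
  shows "convolve X A u \<epsilon> x \<in> W"
  unfolding convolve_def using Hom_closed[OF assms(2,3)]
  by (intro subspace_sum[OF assms(1)]) auto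

text \<open>Serves the induction step with \<open>y = R 0 h x\<close>,
  \<open>f = R (Suc k) h\<close> and \<open>c = inverse (\<epsilon> h)\<close>. All terms change by
  the same invertible linear map, which can therefore be pulled out of the sum.\<close>

lemma convolve_cong_GL:
  assumes "subspace W" and "\<And>\<gamma>. \<gamma> \<in> carrier X \<Longrightarrow> A \<gamma> \<in> Hom scale V scale W"
    and "\<And>\<delta>. \<delta> \<in> carrier X \<Longrightarrow> u \<delta> x \<in> V"
    and "f \<in> carrier (GL scale W)" and "c \<noteq> 0"
    and eq: "\<And>\<gamma> \<delta>. \<gamma> \<in> carrier X \<Longrightarrow> \<delta> \<in> carrier X \<Longrightarrow> \<gamma> \<otimes>\<^bsub>X\<^esub> \<delta> = \<epsilon> \<Longrightarrow>
               A \<gamma> (u \<delta> y) = scale c (f (A \<gamma> (u \<delta> x)))"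
  shows "convolve X A u \<epsilon> y = scale c (f (convolve X A u \<epsilon> x))"
proof -
  let ?I = "\<lambda>z. {(\<gamma>, \<delta>). \<gamma> \<in> carrier X \<and> \<delta> \<in> carrier X \<and> \<gamma> \<otimes>\<^bsub>X\<^esub> \<delta> = \<epsilon> \<and> A \<gamma> (u \<delta> z) \<noteq> 0}"
  have W: "A \<gamma> (u \<delta> x) \<in> W" if "\<gamma> \<in> carrier X" "\<delta> \<in> carrier X" for \<gamma> \<delta>
    using that by (rule Hom_closed[OF assms(2,3)])
  have f: "f \<in> Hom scale W scale W"
    using assms(4) by (simp add: GL_def)
  \<comment> \<open>As the index sets agree, finiteness is irrelevant: otherwise both sums are \<open>0\<close>.\<close>
  have "A \<gamma> (u \<delta> y) = 0 \<longleftrightarrow> A \<gamma> (u \<delta> x) = 0"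
    if "\<gamma> \<in> carrier X" "\<delta> \<in> carrier X" "\<gamma> \<otimes>\<^bsub>X\<^esub> \<delta> = \<epsilon>" for \<gamma> \<delta>
    using that by (simp add: eq GL_eq_0_iff[OF assms(1,4)] W \<open>c \<noteq> 0\<close>)
  then have "?I y = ?I x"
    by blast
  then have "convolve X A u \<epsilon> y = (\<Sum>(\<gamma>, \<delta>) \<in> ?I x. scale c (f (A \<gamma> (u \<delta> x))))"
    unfolding convolve_def by (auto intro!: sum.cong simp: eq)
  also have "\<dots> = scale c (f (convolve X A u \<epsilon> x))"
    unfolding convolve_def using W
    by (subst Hom_sum[OF f assms(1)]) (auto simp: scale_sum_right case_prod_unfold)
  finally show ?thesis .
qed

end

theorem theorem2p1:
  fixes G :: "'g monoid" and TG :: "'g topology"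
    and H :: "'h monoid" and TH :: "'h topology"
    and \<phi> :: "'h \<Rightarrow> 'g"
    and s :: "'f::real_normed_field \<Rightarrow> 'v::ab_group_add \<Rightarrow> 'v"
    and K :: nat
    and V :: "nat \<Rightarrow> 'v set"
    and \<rho> :: "nat \<Rightarrow> 'g \<Rightarrow> ('v \<Rightarrow> 'v) set"
    and R :: "nat \<Rightarrow> 'h \<Rightarrow> 'v \<Rightarrow> 'v"
    and A :: "nat \<Rightarrow> ('h \<Rightarrow> 'f) \<Rightarrow> 'v \<Rightarrow> 'v"
    and \<sigma> :: "nat \<Rightarrow> 'v \<Rightarrow> 'v"
    and v :: "nat \<Rightarrow> ('h \<Rightarrow> 'f) \<Rightarrow> 'v \<Rightarrow> 'v"
  defines "X \<equiv> character_group H TH :: ('h \<Rightarrow> 'f) monoid"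
  assumes "topological_group G TG"
    and "topological_group H TH"
    and "compact_space TH"
    and "group_covering_map H TH G TG \<phi>"
    and "vector_space s"
    and "K \<ge> 1"
    and "\<And>k. k \<le> K \<Longrightarrow> fin_dim_subspace s (V k)"
    and "\<And>k. k \<le> K \<Longrightarrow> projective_rep G s (V k) (\<rho> k)"
    and "\<And>k. k \<le> K \<Longrightarrow> is_lift H TH \<phi> s (V k) (\<rho> k) (R k)"
    and "\<And>k \<epsilon>. k < K \<Longrightarrow> \<epsilon> \<in> carrier X \<Longrightarrow>
           A k \<epsilon> \<in> U_space H s (V k) (V (Suc k)) (R k) (R (Suc k)) \<epsilon>"
    and "\<And>k. k < K \<Longrightarrow> \<sigma> k \<in> V (Suc k) \<rightarrow> V (Suc k)"
    and "\<And>k h x. k < K \<Longrightarrow> h \<in> carrier H \<Longrightarrow> x \<in> V (Suc k) \<Longrightarrow>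
           \<sigma> k (R (Suc k) h x) = R (Suc k) h (\<sigma> k x)"
    and "\<And>\<epsilon> x. \<epsilon> \<in> carrier X \<Longrightarrow> x \<in> V 0 \<Longrightarrow> v 1 \<epsilon> x = \<sigma> 0 (A 0 \<epsilon> x)"
    and "\<And>k \<epsilon> x. 1 \<le> k \<Longrightarrow> k < K \<Longrightarrow> \<epsilon> \<in> carrier X \<Longrightarrow> x \<in> V 0 \<Longrightarrow>
           v (Suc k) \<epsilon> x = \<sigma> k (convolve X (A k) (v k) \<epsilon> x)"
    and "\<And>k \<epsilon> h x. k < K \<Longrightarrow> \<epsilon> \<in> carrier X \<Longrightarrow> h \<in> carrier H \<Longrightarrow> x \<in> V (Suc k) \<Longrightarrow>
           \<sigma> k (s (\<epsilon> h) x) = s (\<epsilon> h) (\<sigma> k x)"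
  shows "\<forall>k\<in>{1..K}. \<forall>\<epsilon>\<in>carrier X. \<forall>h\<in>carrier H. \<forall>x\<in>V 0.
           \<exists>c. c \<noteq> 0 \<and> v k \<epsilon> (R 0 h x) = s c (R k h (v k \<epsilon> x))"
proof -
  interpret vector_space s by fact
  interpret H: topological_group H TH by fact
  have sub: "subspace (V k)" if "k \<le> K" for k
    using assms(8)[OF that] by (simp add: fin_dim_subspace_def)
  have RG: "R k h \<in> carrier (GL s (V k))" and RHom: "R k h \<in> Hom s (V k) s (V k)"
    if "k \<le> K" "h \<in> carrier H" for k h
    using is_lift_GL[OF assms(10)[OF that(1)] that(2)] by (auto simp: GL_def)
  have AHom: "A k \<epsilon> \<in> Hom s (V k) s (V (Suc k))" if "k < K" "\<epsilon> \<in> carrier X" for k \<epsilon>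
    using assms(11)[OF that] by (simp add: U_space_def)
  have X0: "\<epsilon> h \<noteq> 0" and Xinv: "\<epsilon> (inv\<^bsub>H\<^esub> h) = inverse (\<epsilon> h)"
    if "\<epsilon> \<in> carrier X" "h \<in> carrier H" for \<epsilon> h
    using character_groupD[OF H.is_group, of \<epsilon> TH h] that by (simp_all add: X_def)
  have AR: "A k \<epsilon> (R k h x) = s (inverse (\<epsilon> h)) (R (Suc k) h (A k \<epsilon> x))"
    if "k < K" "\<epsilon> \<in> carrier X" "h \<in> carrier H" "x \<in> V k" for k \<epsilon> h x
    using that by (intro U_space_commute[OF sub assms(11) _ RG X0]) auto
  \<comment> \<open>The hypothesis on \<open>\<sigma>\<close> covers scalars that are character
    values, and \<open>inverse (\<epsilon> h)\<close> is one: the value of \<open>\<epsilon>\<close>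
    at the inverse of \<open>h\<close>. Equivariance then moves \<open>R (Suc k) h\<close>
    out.\<close>
  have \<sigma>R: "\<sigma> k (s (inverse (\<epsilon> h)) (R (Suc k) h x)) = s (inverse (\<epsilon> h)) (R (Suc k) h (\<sigma> k x))"
    if "k < K" "\<epsilon> \<in> carrier X" "h \<in> carrier H" "x \<in> V (Suc k)" for k \<epsilon> h x
    using assms(16)[OF that(1,2), of "inv\<^bsub>H\<^esub> h" "R (Suc k) h x"] that
      Hom_closed[OF RHom[of "Suc k" h]] assms(13)[OF that(1,3,4)]
    by (simp add: Xinv)
  have \<sigma>V: "\<sigma> k x \<in> V (Suc k)" if "k < K" "x \<in> V (Suc k)" for k x
    using assms(12)[OF that(1)] that(2) by auto
  have R0: "R 0 h x \<in> V 0" if "h \<in> carrier H" "x \<in> V 0" for h x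
    using Hom_closed[OF RHom[of 0 h]] that by simp
  \<comment> \<open>The mere existence of a scalar is too weak for the induction, as terms with
    unrelated scalars cannot be combined in a sum; so the scalar is made explicit. Membership in
    \<open>V k\<close> is carried along because \<open>A k\<close> is linear only there.\<close>
  have "v k \<epsilon> x \<in> V k \<and> (\<forall>h\<in>carrier H. v k \<epsilon> (R 0 h x) = s (inverse (\<epsilon> h)) (R k h (v k \<epsilon> x)))"
    if "1 \<le> k" "k \<le> K" "\<epsilon> \<in> carrier X" "x \<in> V 0" for k \<epsilon> x
    using that
  \<comment> \<open>\<open>\<epsilon>\<close> is generalized since layer \<open>Suc k\<close> at
    \<open>\<epsilon>\<close> draws on layer \<open>k\<close> at other characters
    \<open>\<delta>\<close>; the vector \<open>x\<close> stays fixed.\<close>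
  proof (induction k arbitrary: \<epsilon> rule: dec_induct)
    case base
    then have "A 0 \<epsilon> x \<in> V (Suc 0)"
      using Hom_closed[OF AHom[of 0 \<epsilon>]] by simp
    then show ?case
      using base \<sigma>V[of 0 "A 0 \<epsilon> x"] \<sigma>R[of 0 \<epsilon> _ "A 0 \<epsilon> x"]
      by (simp add: assms(14)[unfolded One_nat_def] R0 AR)
  next
    case (step k)
    then have k: "1 \<le> k" "k < K" by auto
    have vV: "v k \<delta> x \<in> V k" if "\<delta> \<in> carrier X" for \<delta>
      using step.IH[of \<delta>] step.prems that by simp
    have conv: "convolve X (A k) (v k) \<epsilon> x \<in> V (Suc k)"
      using k by (intro convolve_closed[where V = "V k"] sub AHom vV) auto
    have "convolve X (A k) (v k) \<epsilon> (R 0 h x) =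
        s (inverse (\<epsilon> h)) (R (Suc k) h (convolve X (A k) (v k) \<epsilon> x))" if h: "h \<in> carrier H" for h
    proof (rule convolve_cong_GL[where V = "V k" and W = "V (Suc k)"])
      fix \<gamma> \<delta> assume \<gamma>\<delta>: "\<gamma> \<in> carrier X" "\<delta> \<in> carrier X" "\<gamma> \<otimes>\<^bsub>X\<^esub> \<delta> = \<epsilon>"
      then have "\<epsilon> h = \<gamma> h * \<delta> h"
        using h by (auto simp: X_def character_group_def)
      moreover have "v k \<delta> (R 0 h x) = s (inverse (\<delta> h)) (R k h (v k \<delta> x))"
        using step.IH[of \<delta>] step.prems \<gamma>\<delta> h by simp
      moreover have "R k h (v k \<delta> x) \<in> V k"
        using Hom_closed[OF RHom[of k h]] vV \<gamma>\<delta> k h by simp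
      \<comment> \<open>The factor \<open>inverse (\<delta> h)\<close> leaves
        \<open>A k \<gamma>\<close> by linearity and \<open>AR\<close> contributes
        \<open>inverse (\<gamma> h)\<close>; their product is \<open>inverse (\<epsilon> h)\<close>
        for every pair in the sum.\<close>
      ultimately show "A k \<gamma> (v k \<delta> (R 0 h x)) =
          s (inverse (\<epsilon> h)) (R (Suc k) h (A k \<gamma> (v k \<delta> x)))"
        using k \<gamma>\<delta> h vV Hom_scale[OF AHom[of k \<gamma>]] by (simp add: AR mult.commute)
    qed (use k h step.prems sub AHom vV RG X0 in auto)
    then show ?case
      using k step.prems conv by (simp add: assms(15) R0 \<sigma>R \<sigma>V)
  qed
  \<comment> \<open>The witness is \<open>inverse (\<epsilon> h)\<close>, nonzero by
    \<open>X0\<close>.\<close>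
  then show ?thesis
    using X0 by (meson atLeastAtMost_iff nonzero_imp_inverse_nonzero)
qed

end
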